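(* Let $V$ be a vertex operator algebra, $\nu$ an automorphism of $V$ of period $p>0$ and $\omega_p\in\mathbb{C}$ a primitive $p$-th root of unity. Let $M$ be a vector space (not assumed to be graded) equipped with a linear map $Y_M(\cdot,x):V\to(\mathrm{End}\,M)[[x^{1/p},x^{-1/p}]]$ satisfying the truncation condition and the twisted Jacobi identity, and let $k(u,v)\in\mathbb{N}$ ($u,v\in V$) be as in property (A) of the context. Then for all $u,v\in V$ and $s\in\mathbb{Z}$ (modified weak associativity), $$\lim_{x_1^{1/p}\to\omega_p^s(x_2+x_0)^{1/p}}\Big((x_1-x_2)^{k(u,v)}Y_M(u,x_1)Y_M(v,x_2)\Big)=x_0^{k(u,v)}Y_M(Y(\nu^{-s}u,x_0)v,x_2).$$
   Context: $\mathbb{N}$ denotes the nonnegative integers. $V=(V,Y,\mathbf 1,\omega)$ is a vertex operator algebra over $\mathbb{C}$; an automorphism $\nu$ of period $p$ is a linear automorphism of $V$ preserving $\omega$ and $\mathbf 1$ with $\nu Y(v,x)\nu^{-1}=Y(\nu v,x)$ and $\nu^p=1_V$. Write $Y_M(v,x)=\sum_{n\in\frac1p\mathbb{Z}}v_n^\nu x^{-n-1}$. Truncation condition: for every $v\in V$, $w\in M$, $v_n^\nu w=0$ for $n\in\frac1p\mathbb{Z}$ sufficiently large. Twisted Jacobi identity: for $u,v\in V$, $$x_0^{-1}\delta\Big(\frac{x_1-x_2}{x_0}\Big)Y_M(u,x_1)Y_M(v,x_2)-x_0^{-1}\delta\Big(\frac{x_2-x_1}{-x_0}\Big)Y_M(v,x_2)Y_M(u,x_1)=\frac1p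 x_2^{-1}\sum_{r=0}^{p-1}\delta\Big(\omega_p^r\Big(\frac{x_1-x_0}{x_2}\Big)^{1/p}\Big)Y_M(Y(\nu^ru,x_0)v,x_2),$$ with $\delta(x)=\sum_{n\in\mathbb{Z}}x^n$. Property (A): $k(u,v)\in\mathbb{N}$ (depending only on $u,v$) is such that for every $w\in M$ there are $l(u,w)\in\frac1p\mathbb{N}$ (depending only on $u,w$) and $F(u,v,w;x_0,x_1,x_2)\in M((x_0,x_1^{1/p},x_2^{1/p}))$ with $x_0^{k(u,v)}F\in M[[x_0]]((x_1^{1/p},x_2^{1/p}))$, $x_1^{l(u,w)}F\in M[[x_1^{1/p}]]((x_0,x_2^{1/p}))$, and $$Y_M(u,x_1)Y_M(v,x_2)w=F(u,v,w;x_1-x_2,x_1,x_2),\quad Y_M(v,x_2)Y_M(u,x_1)w=F(u,v,w;-x_2+x_1,x_1,x_2),$$ $$Y_M(Y(\nu^{-s}u,x_0)v,x_2)w=\lim_{x_1^{1/p}\to\omega_p^s(x_2+x_0)^{1/p}}F(u,v,w;x_0,x_1,x_2)\quad(s\in\mathbb{Z}).$$ (Such $k(u,v)$ exist for every $M$ as in the claim.) Binomial expansion convention: binomial expressions are expanded in nonnegative integral powers of the second variable. $M((\ldots))$ denotes formal Laurent series truncated from below in each indicated variable. The formal limit $\lim_{x_1^{1/p}\to\omega_p^s(x_2+x_0)^{1/p}}$ means that each integral power of $x_1^{1/p}$ is replaced by the corresponding power of the formal series $\omega_p^s(x_2+x_0)^{1/p}$. *)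

theory Defs
  imports Complex_Main "HOL-Library.Groups_Big_Fun" "HOL-Library.Product_Plus"
begin

section \<open>Formal series\<close>

text \<open>
  A formal series in \<open>x\<^sub>0\<close>, \<open>x\<^sub>1^(1/p)\<close>, \<open>x\<^sub>2^(1/p)\<close>, infinite in all directions, is its family of
  coefficients: \<open>F (i, a, b)\<close> is the coefficient of \<open>x\<^sub>0^i x\<^sub>1^(a/p) x\<^sub>2^(b/p)\<close>.  Thus \<open>x\<^sub>1^m\<close> has
  exponent \<open>p * m\<close> in the second component.  Infinite sums of series are taken coefficientwise
  and are sums with finitely many nonzero terms (\<^const>\<open>Sum_any\<close>, which is \<open>0\<close> on a family with
  infinitely many nonzero terms).
\<close>

type_synonym 'a fser = "int \<times> int \<times> int \<Rightarrow> 'a"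

definition xmon :: "int \<Rightarrow> int \<Rightarrow> int \<Rightarrow> complex fser" where
  "xmon i a b = (\<lambda>e. if e = (i, a, b) then 1 else 0)"

definition fsum :: "('i \<Rightarrow> 'a::comm_monoid_add fser) \<Rightarrow> 'a fser" where
  "fsum f = (\<lambda>e. Sum_any (\<lambda>i. f i e))"

definition fscale :: "(complex \<Rightarrow> 'a \<Rightarrow> 'a) \<Rightarrow> complex \<Rightarrow> 'a fser \<Rightarrow> 'a fser" where
  "fscale s c F = (\<lambda>e. s c (F e))"

text \<open>Product of a scalar series and a vector-valued series; \<open>s\<close> is the scalar multiplication.\<close>

definition fmul :: "(complex \<Rightarrow> 'a::comm_monoid_add \<Rightarrow> 'a) \<Rightarrow> complex fser \<Rightarrow> 'a fser \<Rightarrow> 'a fser" where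
  "fmul s K F = (\<lambda>e. Sum_any (\<lambda>d. s (K d) (F (e - d))))"

text \<open>
  Formal substitution: every monomial \<open>x^d\<close> of \<open>F\<close> is replaced by the scalar series \<open>\<phi> d\<close>.  The
  relation states that the result exists (each coefficient is a finite sum) and equals \<open>H\<close>.
\<close>

definition has_subst ::
    "(complex \<Rightarrow> 'a::comm_monoid_add \<Rightarrow> 'a) \<Rightarrow> (int \<times> int \<times> int \<Rightarrow> complex fser) \<Rightarrow> 'a fser \<Rightarrow> 'a fser \<Rightarrow> bool"
  where
  "has_subst s \<phi> F H \<longleftrightarrow>
     (\<forall>e. finite {d. s (\<phi> d e) (F d) \<noteq> 0} \<and> Sum_any (\<lambda>d. s (\<phi> d e) (F d)) = H e)"


subsection \<open>Binomial expansions, in nonnegative integral powers of the second summand\<close>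

text \<open>\<open>(x\<^sub>1 - x\<^sub>2)^n\<close>\<close>
definition pow_x1_minus_x2 :: "nat \<Rightarrow> int \<Rightarrow> complex fser" where
  "pow_x1_minus_x2 p n = fsum (\<lambda>j::nat. fscale (*) ((of_int n gchoose j) * (-1) ^ j)
     (xmon 0 (int p * (n - int j)) (int p * int j)))"

text \<open>\<open>(x\<^sub>2 - x\<^sub>1)^n\<close>\<close>
definition pow_x2_minus_x1 :: "nat \<Rightarrow> int \<Rightarrow> complex fser" where
  "pow_x2_minus_x1 p n = fsum (\<lambda>j::nat. fscale (*) ((of_int n gchoose j) * (-1) ^ j)
     (xmon 0 (int p * int j) (int p * (n - int j))))"

text \<open>\<open>(x\<^sub>1 - x\<^sub>0)^(m/p)\<close>\<close>
definition pow_x1_minus_x0 :: "nat \<Rightarrow> int \<Rightarrow> complex fser" where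
  "pow_x1_minus_x0 p m = fsum (\<lambda>j::nat. fscale (*) (((of_int m / of_nat p) gchoose j) * (-1) ^ j)
     (xmon (int j) (m - int p * int j) 0))"

text \<open>\<open>(x\<^sub>2 + x\<^sub>0)^(m/p)\<close>\<close>
definition pow_x2_plus_x0 :: "nat \<Rightarrow> int \<Rightarrow> complex fser" where
  "pow_x2_plus_x0 p m = fsum (\<lambda>j::nat. fscale (*) ((of_int m / of_nat p) gchoose j)
     (xmon (int j) 0 (m - int p * int j)))"


subsection \<open>Delta functions\<close>

text \<open>\<open>x\<^sub>0^(-1) \<delta>((x\<^sub>1 - x\<^sub>2)/x\<^sub>0)\<close>\<close>
definition delta_x1_minus_x2 :: "nat \<Rightarrow> complex fser" where
  "delta_x1_minus_x2 p =
     fsum (\<lambda>n::int. fmul (*) (xmon (- n - 1) 0 0) (pow_x1_minus_x2 p n))"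

text \<open>\<open>x\<^sub>0^(-1) \<delta>((x\<^sub>2 - x\<^sub>1)/(-x\<^sub>0))\<close>\<close>
definition delta_x2_minus_x1 :: "nat \<Rightarrow> complex fser" where
  "delta_x2_minus_x1 p =
     fsum (\<lambda>n::int. fscale (*) ((-1) powi n) (fmul (*) (xmon (- n - 1) 0 0) (pow_x2_minus_x1 p n)))"

text \<open>\<open>x\<^sub>2^(-1) \<delta>(\<omega>\<^sub>p^r ((x\<^sub>1 - x\<^sub>0)/x\<^sub>2)^(1/p))\<close>\<close>
definition delta_x1_minus_x0 :: "nat \<Rightarrow> complex \<Rightarrow> nat \<Rightarrow> complex fser" where
  "delta_x1_minus_x0 p \<omega>\<^sub>p r =
     fsum (\<lambda>n::int. fscale (*) ((\<omega>\<^sub>p ^ r) powi n)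
       (fmul (*) (xmon 0 0 (- n - int p)) (pow_x1_minus_x0 p n)))"


subsection \<open>Substitutions and limits\<close>

text \<open>\<open>F(x\<^sub>1 - x\<^sub>2, x\<^sub>1, x\<^sub>2) = H\<close>\<close>
definition subst_x1_minus_x2 ::
    "(complex \<Rightarrow> 'a::comm_monoid_add \<Rightarrow> 'a) \<Rightarrow> nat \<Rightarrow> 'a fser \<Rightarrow> 'a fser \<Rightarrow> bool" where
  "subst_x1_minus_x2 s p =
     has_subst s (\<lambda>(i, a, b). fmul (*) (xmon 0 a b) (pow_x1_minus_x2 p i))"

text \<open>\<open>F(-x\<^sub>2 + x\<^sub>1, x\<^sub>1, x\<^sub>2) = H\<close>, where \<open>(-x\<^sub>2 + x\<^sub>1)^i = (-1)^i (x\<^sub>2 - x\<^sub>1)^i\<close>\<close>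
definition subst_minus_x2_plus_x1 ::
    "(complex \<Rightarrow> 'a::comm_monoid_add \<Rightarrow> 'a) \<Rightarrow> nat \<Rightarrow> 'a fser \<Rightarrow> 'a fser \<Rightarrow> bool" where
  "subst_minus_x2_plus_x1 s p =
     has_subst s (\<lambda>(i, a, b). fscale (*) ((-1) powi i) (fmul (*) (xmon 0 a b) (pow_x2_minus_x1 p i)))"

text \<open>The formal limit of \<open>F\<close> as \<open>x\<^sub>1^(1/p) \<rightarrow> \<omega>\<^sub>p^t (x\<^sub>2 + x\<^sub>0)^(1/p)\<close> exists and equals \<open>H\<close>.\<close>
definition formal_limit ::
    "(complex \<Rightarrow> 'a::comm_monoid_add \<Rightarrow> 'a) \<Rightarrow> nat \<Rightarrow> complex \<Rightarrow> int \<Rightarrow> 'a fser \<Rightarrow> 'a fser \<Rightarrow> bool" where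
  "formal_limit s p \<omega>\<^sub>p t =
     has_subst s (\<lambda>(i, a, b). fscale (*) ((\<omega>\<^sub>p powi t) powi a)
       (fmul (*) (xmon i 0 b) (pow_x2_plus_x0 p a)))"


subsection \<open>Spaces of truncated series\<close>

text \<open>\<open>M((x\<^sub>0, x\<^sub>1^(1/p), x\<^sub>2^(1/p)))\<close>\<close>
definition laurent_x0_x1_x2 :: "'a::zero fser set" where
  "laurent_x0_x1_x2 = {F. \<exists>N. \<forall>i a b. F (i, a, b) \<noteq> 0 \<longrightarrow> N \<le> i \<and> N \<le> a \<and> N \<le> b}"

text \<open>\<open>M[[x\<^sub>0]]((x\<^sub>1^(1/p), x\<^sub>2^(1/p)))\<close>\<close>
definition power_x0_laurent_x1_x2 :: "'a::zero fser set" where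
  "power_x0_laurent_x1_x2 = {F. \<exists>N. \<forall>i a b. F (i, a, b) \<noteq> 0 \<longrightarrow> 0 \<le> i \<and> N \<le> a \<and> N \<le> b}"

text \<open>\<open>M[[x\<^sub>1^(1/p)]]((x\<^sub>0, x\<^sub>2^(1/p)))\<close>\<close>
definition power_x1_laurent_x0_x2 :: "'a::zero fser set" where
  "power_x1_laurent_x0_x2 = {F. \<exists>N. \<forall>i a b. F (i, a, b) \<noteq> 0 \<longrightarrow> N \<le> i \<and> 0 \<le> a \<and> N \<le> b}"


section \<open>Vertex operators\<close>

text \<open>
  A linear map \<open>Y\<^sub>M(\<cdot>, x) : V \<rightarrow> (End M)[[x^(1/p), x^(-1/p)]]\<close> is given by its coefficients:
  \<open>YM v a\<close> is the coefficient of \<open>x^(a/p)\<close>.  The vertex operator map \<open>Y\<close> of \<open>V\<close> itself is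
  represented in the same way with \<open>p = 1\<close>.
\<close>

definition vertex_operator_map ::
    "(complex \<Rightarrow> 'v::ab_group_add \<Rightarrow> 'v) \<Rightarrow> (complex \<Rightarrow> 'm::ab_group_add \<Rightarrow> 'm) \<Rightarrow>
      ('v \<Rightarrow> int \<Rightarrow> 'm \<Rightarrow> 'm) \<Rightarrow> bool" where
  "vertex_operator_map sV sM YM \<longleftrightarrow>
     (\<forall>v a. Vector_Spaces.linear sM sM (YM v a)) \<and>
     (\<forall>a w. Vector_Spaces.linear sV sM (\<lambda>v. YM v a w))"

text \<open>
  \<open>mode p YM v n\<close> is the operator \<open>v\<close> with mode index \<open>n/p\<close>, that is, the coefficient of
  \<open>x^(-n/p - 1)\<close>.
\<close>

definition mode :: "nat \<Rightarrow> ('v \<Rightarrow> int \<Rightarrow> 'm \<Rightarrow> 'm) \<Rightarrow> 'v \<Rightarrow> int \<Rightarrow> 'm \<Rightarrow> 'm" where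
  "mode p YM v n = YM v (- n - int p)"

definition truncation_condition :: "nat \<Rightarrow> ('v \<Rightarrow> int \<Rightarrow> 'm::zero \<Rightarrow> 'm) \<Rightarrow> bool" where
  "truncation_condition p YM \<longleftrightarrow> (\<forall>v w. \<exists>N. \<forall>n\<ge>N. mode p YM v n w = 0)"

text \<open>\<open>Y\<^sub>M(u, x\<^sub>1) Y\<^sub>M(v, x\<^sub>2) w\<close>\<close>
definition prod_x1_x2 :: "('v \<Rightarrow> int \<Rightarrow> 'm::zero \<Rightarrow> 'm) \<Rightarrow> 'v \<Rightarrow> 'v \<Rightarrow> 'm \<Rightarrow> 'm fser" where
  "prod_x1_x2 YM u v w = (\<lambda>(i, a, b). if i = 0 then YM u a (YM v b w) else 0)"

text \<open>\<open>Y\<^sub>M(v, x\<^sub>2) Y\<^sub>M(u, x\<^sub>1) w\<close>\<close>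
definition prod_x2_x1 :: "('v \<Rightarrow> int \<Rightarrow> 'm::zero \<Rightarrow> 'm) \<Rightarrow> 'v \<Rightarrow> 'v \<Rightarrow> 'm \<Rightarrow> 'm fser" where
  "prod_x2_x1 YM v u w = (\<lambda>(i, a, b). if i = 0 then YM v b (YM u a w) else 0)"

text \<open>\<open>Y\<^sub>M(Y(u, x\<^sub>0) v, x\<^sub>2) w\<close>\<close>
definition iterate_x0_x2 ::
    "('v \<Rightarrow> int \<Rightarrow> 'v \<Rightarrow> 'v) \<Rightarrow> ('v \<Rightarrow> int \<Rightarrow> 'm::zero \<Rightarrow> 'm) \<Rightarrow> 'v \<Rightarrow> 'v \<Rightarrow> 'm \<Rightarrow> 'm fser" where
  "iterate_x0_x2 Y YM u v w = (\<lambda>(i, a, b). if a = 0 then YM (Y u i v) b w else 0)"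

definition twisted_jacobi ::
    "(complex \<Rightarrow> 'm::ab_group_add \<Rightarrow> 'm) \<Rightarrow> nat \<Rightarrow> complex \<Rightarrow> ('v \<Rightarrow> 'v) \<Rightarrow>
      ('v \<Rightarrow> int \<Rightarrow> 'v \<Rightarrow> 'v) \<Rightarrow> ('v \<Rightarrow> int \<Rightarrow> 'm \<Rightarrow> 'm) \<Rightarrow> bool" where
  "twisted_jacobi sM p \<omega>\<^sub>p \<nu> Y YM \<longleftrightarrow>
     (\<forall>u v w e.
        fmul sM (delta_x1_minus_x2 p) (prod_x1_x2 YM u v w) e
        - fmul sM (delta_x2_minus_x1 p) (prod_x2_x1 YM v u w) e
        = sM (1 / of_nat p)
            (\<Sum>r = 0..<p. fmul sM (delta_x1_minus_x0 p \<omega>\<^sub>p r) (iterate_x0_x2 Y YM ((\<nu> ^^ r) u) v w) e))"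


section \<open>Vertex operator algebras and their automorphisms\<close>

text \<open>
  \<open>Vgr n\<close> is the homogeneous subspace of weight \<open>n\<close>, \<open>vac\<close> the vacuum and \<open>om\<close> the conformal vector,
  with \<open>L(n)\<close> the mode of \<open>om\<close> of index \<open>n + 1\<close>.  The ordinary Jacobi identity is the case \<open>p = 1\<close>,
  \<open>\<omega>\<^sub>p = 1\<close>, \<open>\<nu> = id\<close>, \<open>YM = Y\<close> of the twisted one.
\<close>

locale vertex_operator_algebra = vector_space scale
  for scale :: "complex \<Rightarrow> 'v::ab_group_add \<Rightarrow> 'v" +
  fixes Vgr :: "int \<Rightarrow> 'v set"
    and Y :: "'v \<Rightarrow> int \<Rightarrow> 'v \<Rightarrow> 'v"
    and vac om :: 'v
  assumes subspace_Vgr: "subspace (Vgr n)"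
    and direct_sum_Vgr:
      "\<exists>!f. (\<forall>n. f n \<in> Vgr n) \<and> finite {n. f n \<noteq> 0} \<and> Sum_any f = v"
    and finite_dim_Vgr: "\<exists>B. finite B \<and> span B = Vgr n"
    and Vgr_bounded_below: "\<exists>N. \<forall>n<N. Vgr n = {0}"
    and Y_map: "vertex_operator_map scale scale Y"
    and Y_truncation: "truncation_condition 1 Y"
    and vacuum: "Y vac n v = (if n = 0 then v else 0)"
    and creation: "n < 0 \<Longrightarrow> Y v n vac = 0" "Y v 0 vac = v"
    and jacobi: "twisted_jacobi scale 1 1 id Y Y"
    and vac_weight: "vac \<in> Vgr 0"
    and om_weight: "om \<in> Vgr 2"
    and virasoro:
      "\<exists>c. \<forall>m n v.
         mode 1 Y om (m + 1) (mode 1 Y om (n + 1) v) - mode 1 Y om (n + 1) (mode 1 Y om (m + 1) v)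
         = scale (of_int (m - n)) (mode 1 Y om (m + n + 1) v)
           + (if m + n = 0 then scale (of_int (m ^ 3 - m) / 12 * c) v else 0)"
    and L0_grading: "v \<in> Vgr n \<Longrightarrow> mode 1 Y om 1 v = scale (of_int n) v"
    and L_minus_1_derivative: "Y (mode 1 Y om 0 v) n u = scale (of_int (n + 1)) (Y v (n + 1) u)"

text \<open>The period \<open>p\<close> is not required to be minimal.\<close>

definition voa_automorphism ::
    "(complex \<Rightarrow> 'v::ab_group_add \<Rightarrow> 'v) \<Rightarrow> ('v \<Rightarrow> int \<Rightarrow> 'v \<Rightarrow> 'v) \<Rightarrow> 'v \<Rightarrow> 'v \<Rightarrow> nat \<Rightarrow> ('v \<Rightarrow> 'v) \<Rightarrow> bool"
  where
  "voa_automorphism sV Y vac om p \<nu> \<longleftrightarrow>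
     Vector_Spaces.linear sV sV \<nu> \<and> bij \<nu> \<and> \<nu> om = om \<and> \<nu> vac = vac \<and>
     (\<forall>v n. \<nu> \<circ> Y v n \<circ> inv \<nu> = Y (\<nu> v) n) \<and> \<nu> ^^ p = id"

definition int_iterate :: "('a \<Rightarrow> 'a) \<Rightarrow> int \<Rightarrow> 'a \<Rightarrow> 'a" where
  "int_iterate f n = (if 0 \<le> n then f ^^ nat n else inv f ^^ nat (- n))"

definition primitive_root_of_unity :: "nat \<Rightarrow> complex \<Rightarrow> bool" where
  "primitive_root_of_unity p z \<longleftrightarrow> z ^ p = 1 \<and> (\<forall>k. 0 < k \<and> k < p \<longrightarrow> z ^ k \<noteq> 1)"


section \<open>The function \<open>k(u, v)\<close>\<close>

text \<open>The natural number \<open>l u w\<close> is \<open>p\<close> times the element \<open>l(u, w)\<close> of \<open>(1/p)\<nat>\<close>.\<close>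

definition property_A ::
    "(complex \<Rightarrow> 'm::ab_group_add \<Rightarrow> 'm) \<Rightarrow> nat \<Rightarrow> complex \<Rightarrow> ('v \<Rightarrow> 'v) \<Rightarrow>
      ('v \<Rightarrow> int \<Rightarrow> 'v \<Rightarrow> 'v) \<Rightarrow> ('v \<Rightarrow> int \<Rightarrow> 'm \<Rightarrow> 'm) \<Rightarrow> ('v \<Rightarrow> 'v \<Rightarrow> nat) \<Rightarrow> bool" where
  "property_A sM p \<omega>\<^sub>p \<nu> Y YM k \<longleftrightarrow>
     (\<exists>l :: 'v \<Rightarrow> 'm \<Rightarrow> nat. \<forall>u v w. \<exists>F \<in> laurent_x0_x1_x2.
        fmul sM (xmon (int (k u v)) 0 0) F \<in> power_x0_laurent_x1_x2 \<and>
        fmul sM (xmon 0 (int (l u w)) 0) F \<in> power_x1_laurent_x0_x2 \<and>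
        subst_x1_minus_x2 sM p F (prod_x1_x2 YM u v w) \<and>
        subst_minus_x2_plus_x1 sM p F (prod_x2_x1 YM v u w) \<and>
        (\<forall>s. formal_limit sM p \<omega>\<^sub>p s F (iterate_x0_x2 Y YM (int_iterate \<nu> (- s) u) v w)))"

end

theory Submission
  imports Defs "HOL-Computational_Algebra.Formal_Power_Series"
begin

text \<open>
  Let \<open>n = k(u, v)\<close> and let \<open>F\<close> be the series of property (A).  By the Vandermonde identity,
  \<open>(x\<^sub>1 - x\<^sub>2)^n F(x\<^sub>1 - x\<^sub>2, x\<^sub>1, x\<^sub>2)\<close> is \<open>x\<^sub>0^n F\<close> at \<open>x\<^sub>0 = x\<^sub>1 - x\<^sub>2\<close>, and \<open>x\<^sub>0^n F\<close> has only
  nonnegative powers of \<open>x\<^sub>0\<close>, so the formal limit may be taken monomial by monomial, all sums being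
  finite.  What remains is that the limit of \<open>(x\<^sub>1 - x\<^sub>2)^m x\<^sub>1^(a/p)\<close> for \<open>m \<in> \<nat>\<close> is
  \<open>x\<^sub>0^m\<close> times the limit of \<open>x\<^sub>1^(a/p)\<close>, which comes down to the \<open>m\<close>-th backward difference
  of a binomial coefficient in its upper argument.
\<close>

section \<open>Coefficients of monomial products and binomial expansions\<close>

text \<open>Collapses the sums defining binomial expansions: a given exponent is attained by at most
  one index, and \<open>Q\<close> says whether it is attained at all.\<close>

lemma Sum_any_eq_if:
  fixes f :: "'i \<Rightarrow> 'b::comm_monoid_add"
  assumes "\<And>j. P j \<longleftrightarrow> Q \<and> j = i"
  shows "Sum_any (\<lambda>j. if P j then f j else 0) = (if Q then f i else 0)"
proof -
  have "Sum_any (\<lambda>j. if P j then f j else 0) = (\<Sum>j\<in>{i}. if P j then f j else 0)"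
    by (rule Sum_any.expand_superset) (auto simp: assms)
  then show ?thesis by (simp add: assms)
qed

lemma fmul_xmon:
  assumes "vector_space s"
  shows "fmul s (xmon i a b) F e = F (e - (i, a, b))"
proof -
  interpret vector_space s by fact
  have "fmul s (xmon i a b) F e = Sum_any (\<lambda>d. if d = (i, a, b) then F (e - d) else 0)"
    unfolding fmul_def xmon_def by (rule arg_cong[where f = Sum_any]) auto
  also have "\<dots> = F (e - (i, a, b))"
    using Sum_any_eq_if[of "\<lambda>d. d = (i, a, b)" True "(i, a, b)" "\<lambda>d. F (e - d)"] by simp
  finally show ?thesis .
qed

lemma vector_space_mult_complex: "vector_space ((*) :: complex \<Rightarrow> complex \<Rightarrow> complex)"
  by unfold_locales (auto simp: algebra_simps)

lemmas fmul_xmon_complex = fmul_xmon[OF vector_space_mult_complex]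

lemma pow_x1_minus_x2_eq:
  assumes "p > 0"
  shows "pow_x1_minus_x2 p n (i, a, b) =
    (if i = 0 \<and> int p dvd b \<and> 0 \<le> b \<and> a = int p * n - b
     then (of_int n gchoose nat (b div int p)) * (-1) ^ nat (b div int p) else 0)"
proof -
  have iff: "(i, a, b) = (0, int p * (n - int j), int p * int j) \<longleftrightarrow>
      (i = 0 \<and> int p dvd b \<and> 0 \<le> b \<and> a = int p * n - b) \<and> j = nat (b div int p)" for j
    using assms by (auto simp: algebra_simps elim!: dvdE simp: zero_le_mult_iff)
  have "pow_x1_minus_x2 p n (i, a, b) =
     Sum_any (\<lambda>j. if (i, a, b) = (0, int p * (n - int j), int p * int j)
       then (of_int n gchoose j) * (-1) ^ j else 0)"
    unfolding pow_x1_minus_x2_def fsum_def fscale_def xmon_def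
    by (rule arg_cong[where f = Sum_any]) auto
  then show ?thesis
    by (simp only: Sum_any_eq_if[OF iff])
qed

lemma pow_x2_plus_x0_eq:
  "pow_x2_plus_x0 p m (i, a, b) =
    (if 0 \<le> i \<and> a = 0 \<and> b = m - int p * i then (of_int m / of_nat p) gchoose nat i else 0)"
proof -
  have iff: "(i, a, b) = (int j, 0, m - int p * int j) \<longleftrightarrow>
      (0 \<le> i \<and> a = 0 \<and> b = m - int p * i) \<and> j = nat i" for j
    by auto
  have "pow_x2_plus_x0 p m (i, a, b) =
     Sum_any (\<lambda>j. if (i, a, b) = (int j, 0, m - int p * int j)
       then (of_int m / of_nat p) gchoose j else 0)"
    unfolding pow_x2_plus_x0_def fsum_def fscale_def xmon_def
    by (rule arg_cong[where f = Sum_any]) auto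
  then show ?thesis
    by (simp only: Sum_any_eq_if[OF iff])
qed

section \<open>Products of powers of x1 - x2\<close>

text \<open>The binomial coefficients vanish beyond \<open>j = n\<close>, so multiplication by a
  natural power is a finite sum even on series infinite in all directions.\<close>

lemma pow_x1_minus_x2_nat_support:
  assumes "p > 0"
  shows "{d. pow_x1_minus_x2 p (int n) d \<noteq> 0} \<subseteq>
    (\<lambda>j. (0, int p * (int n - int j), int p * int j)) ` {..n}"
proof
  fix d assume "d \<in> {d. pow_x1_minus_x2 p (int n) d \<noteq> 0}"
  moreover obtain i a b where d: "d = (i, a, b)" by (cases d)
  ultimately have *: "i = 0" "int p dvd b" "0 \<le> b" "a = int p * int n - b"
    and nz: "(of_nat n gchoose nat (b div int p) :: complex) \<noteq> 0"
    by (auto simp: pow_x1_minus_x2_eq[OF assms] split: if_splits)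
  from nz have "nat (b div int p) \<le> n"
    by (metis binomial_eq_0_iff binomial_gbinomial not_le of_nat_0)
  moreover have "b = int p * int (nat (b div int p))"
    using * assms by (simp add: pos_imp_zdiv_nonneg_iff)
  ultimately show "d \<in> (\<lambda>j. (0, int p * (int n - int j), int p * int j)) ` {..n}"
    unfolding d by (intro image_eqI[of _ _ "nat (b div int p)"]) (auto simp: * algebra_simps)
qed

text \<open>The family \<open>g\<close> is arbitrary so as to serve both products, where
  \<open>g d\<close> is a coefficient at \<open>e - d\<close>, and formal limits, where
  \<open>g d\<close> comes from the limit of a shifted monomial.\<close>

lemma Sum_any_pow_x1_minus_x2_nat:
  assumes "vector_space s" "p > 0"
  shows "Sum_any (\<lambda>d. s (pow_x1_minus_x2 p (int n) d) (g d)) =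
    (\<Sum>j\<le>n. s (of_nat (n choose j) * (-1) ^ j) (g (0, int p * (int n - int j), int p * int j)))"
proof -
  interpret vector_space s by fact
  let ?c = "\<lambda>j. (0::int, int p * (int n - int j), int p * int j)"
  have "Sum_any (\<lambda>d. s (pow_x1_minus_x2 p (int n) d) (g d)) =
      (\<Sum>d\<in>?c ` {..n}. s (pow_x1_minus_x2 p (int n) d) (g d))"
    using pow_x1_minus_x2_nat_support[OF assms(2), of n]
    by (intro Sum_any.expand_superset) auto
  also have "\<dots> = (\<Sum>j\<le>n. s (pow_x1_minus_x2 p (int n) (?c j)) (g (?c j)))"
    using assms(2) by (subst sum.reindex) (auto simp: inj_on_def)
  also have "\<dots> = (\<Sum>j\<le>n. s (of_nat (n choose j) * (-1) ^ j) (g (?c j)))"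
    using assms(2)
    by (intro sum.cong refl) (simp add: pow_x1_minus_x2_eq binomial_gbinomial algebra_simps)
  finally show ?thesis .
qed

text \<open>Vandermonde convolution, read at the exponent \<open>e\<close>, yields the exponent law
  for powers of x1 - x2. The integer \<open>n\<close> may be negative, in which case its factor is
  an infinite expansion.\<close>

lemma pow_x1_minus_x2_add_nat:
  assumes "p > 0"
  shows "(\<Sum>j\<le>k. of_nat (k choose j) * (-1) ^ j *
      pow_x1_minus_x2 p n (e - (0, int p * (int k - int j), int p * int j))) =
    pow_x1_minus_x2 p (int k + n) e"
proof -
  obtain i a b where e: "e = (i, a, b)" by (cases e)
  show ?thesis
  proof (cases "i = 0 \<and> int p dvd b \<and> 0 \<le> b \<and> a = int p * (int k + n) - b")
    case True
    then obtain m where b: "b = int p * int m"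
      using assms by (metis dvdE nat_0_le of_nat_0_less_iff zero_le_mult_iff not_less)
    \<comment> \<open>The guard \<open>j \<le> m\<close> reflects that the second factor has no
      negative powers of x2; the two signs always combine to \<open>(-1) ^ m\<close>.\<close>
    have "(\<Sum>j\<le>k. of_nat (k choose j) * (-1) ^ j *
        pow_x1_minus_x2 p n (e - (0, int p * (int k - int j), int p * int j))) =
      (\<Sum>j\<le>k. if j \<le> m then (-1) ^ m * ((of_nat k gchoose j) * (of_int n gchoose (m - j))) else 0)"
    proof (rule sum.cong[OF refl])
      fix j
      have "int p * int m - int p * int j = int p * (int m - int j)" by (simp add: algebra_simps)
      moreover have "(-1::complex) ^ j * (-1) ^ (m - j) = (-1) ^ m" if "j \<le> m"
        using that by (simp flip: power_add)
      ultimately show "of_nat (k choose j) * (-1) ^ j *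
          pow_x1_minus_x2 p n (e - (0, int p * (int k - int j), int p * int j)) =
        (if j \<le> m then (-1) ^ m * ((of_nat k gchoose j) * (of_int n gchoose (m - j))) else 0)"
        using True assms
        by (auto simp: e b pow_x1_minus_x2_eq binomial_gbinomial zero_le_mult_iff nat_diff_distrib
            algebra_simps)
    qed
    \<comment> \<open>The ranges can be exchanged: the binomial coefficient vanishes beyond
      \<open>k\<close>, the guarded term beyond \<open>m\<close>.\<close>
    also have "\<dots> = (\<Sum>j\<le>m. (-1) ^ m * ((of_nat k gchoose j) * (of_int n gchoose (m - j))))"
    proof -
      have "(of_nat k gchoose j :: complex) = 0" if "k < j" for j
        using that by (metis binomial_eq_0_iff binomial_gbinomial of_nat_0)
      then show ?thesis
        by (intro sum.mono_neutral_cong[of "{..m}" "{..k}"]) auto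
    qed
    also have "\<dots> = (-1) ^ m * (of_nat k + of_int n gchoose m)"
      by (simp add: atMost_atLeast0 flip: sum_distrib_left gbinomial_Vandermonde)
    also have "\<dots> = pow_x1_minus_x2 p (int k + n) e"
      using True assms by (simp add: e b pow_x1_minus_x2_eq)
    finally show ?thesis .
  next
    case False
    \<comment> \<open>Exponents of the two factors add up, so a nonzero summand would put
      \<open>e\<close> into the exponent range excluded by this case.\<close>
    have "pow_x1_minus_x2 p n (e - (0, int p * (int k - int j), int p * int j)) = 0" for j
    proof (rule ccontr)
      assume "\<not> ?thesis"
      then have "i = 0" "int p dvd b - int p * int j" "int p * int j \<le> b"
         "a - int p * (int k - int j) = int p * n - (b - int p * int j)"
        by (auto simp: e pow_x1_minus_x2_eq[OF assms] split: if_splits)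
      moreover from \<open>int p * int j \<le> b\<close> have "0 \<le> b"
        by (rule order_trans[rotated]) simp
      moreover from \<open>int p dvd b - int p * int j\<close> have "int p dvd b"
        by (metis dvd_triv_left zdvd_zdiffD)
      ultimately show False using False by (simp add: algebra_simps)
    qed
    then show ?thesis using False assms by (auto simp: e pow_x1_minus_x2_eq simp del: diff_Pair)
  qed
qed

section \<open>The formal limit of natural powers of x1 - x2\<close>

text \<open>Compare the coefficients of t^m in (1 + t)^x ((1 + t) - 1)^n = t^n (1 + t)^x. In the
  induction, Pascal's rule for row \<open>Suc n\<close> gives a difference of two
  \<open>n\<close>-th differences, at \<open>x + 1\<close> and at \<open>x\<close>; Pascal's rule in
  the upper argument then lowers \<open>m\<close> by one.\<close>

lemma gbinomial_backward_difference:
  fixes x :: complex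
  shows "(\<Sum>j\<le>n. of_nat (n choose j) * (-1) ^ j * ((x + of_nat n - of_nat j) gchoose m)) =
    (if n \<le> m then x gchoose (m - n) else 0)"
proof (induction n arbitrary: m)
  case (Suc n)
  let ?f = "\<lambda>y j. of_nat (n choose j) * (-1) ^ j * ((y + of_nat n - of_nat j) gchoose m)"
  let ?g = "\<lambda>j. (x + of_nat (Suc n) - of_nat j) gchoose m"
  have "(\<Sum>j\<le>Suc n. of_nat (Suc n choose j) * (-1) ^ j * ?g j) =
      (\<Sum>j\<le>n. of_nat (n choose j) * (-1) ^ j * ?g j) -
      (\<Sum>j\<le>n. of_nat (n choose j) * (-1) ^ j * ?g (Suc j))"
  proof -
    have "(\<Sum>j\<le>Suc n. of_nat (Suc n choose j) * (-1) ^ j * ?g j) =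
       ?g 0 + (\<Sum>j\<le>n. of_nat (n choose Suc j) * (-1) ^ Suc j * ?g (Suc j))
        + (\<Sum>j\<le>n. of_nat (n choose j) * (-1) ^ Suc j * ?g (Suc j))"
      by (subst sum.atMost_Suc_shift) (simp add: algebra_simps sum.distrib sum_negf sum_subtractf)
    \<comment> \<open>The new last index adds nothing, since \<open>n choose Suc n\<close> is
      0.\<close>
    also have "?g 0 + (\<Sum>j\<le>n. of_nat (n choose Suc j) * (-1) ^ Suc j * ?g (Suc j)) =
      (\<Sum>j\<le>Suc n. of_nat (n choose j) * (-1) ^ j * ?g j)"
      by (subst sum.atMost_Suc_shift) simp
    finally show ?thesis by (simp add: sum_negf)
  qed
  also have "\<dots> = (\<Sum>j\<le>n. ?f (x + 1) j - ?f x j)"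
    by (simp add: sum_subtractf algebra_simps)
  also have "\<dots> = (if Suc n \<le> m then x gchoose (m - Suc n) else 0)"
  proof (cases m)
    case 0
    then show ?thesis by simp
  next
    case (Suc m')
    have "?f (x + 1) j - ?f x j =
        of_nat (n choose j) * (-1) ^ j * ((x + of_nat n - of_nat j) gchoose m')" for j
    proof -
      have "x + 1 + of_nat n - of_nat j = (x + of_nat n - of_nat j) + 1" by simp
      then show ?thesis unfolding Suc
        by (simp only: gbinomial_Suc_Suc) (simp add: algebra_simps)
    qed
    then show ?thesis using Suc.IH[of m'] by (simp add: Suc)
  qed
  finally show ?case .
qed auto

text \<open>What the formal limit puts in place of the monomial x0^i x1^(a/p) x2^(b/p), with
  \<open>z\<close> standing for \<open>\<omega>\<^sub>p powi t\<close>.\<close>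

definition limit_kernel :: "nat \<Rightarrow> complex \<Rightarrow> int \<times> int \<times> int \<Rightarrow> complex fser" where
  "limit_kernel p z = (\<lambda>(i, a, b). fscale (*) (z powi a) (fmul (*) (xmon i 0 b) (pow_x2_plus_x0 p a)))"

lemma limit_kernel_eq:
  "limit_kernel p z (i, a, b) (i', a', b') =
    (if i \<le> i' \<and> a' = 0 \<and> b' = a + b - int p * (i' - i)
     then z powi a * ((of_int a / of_nat p) gchoose nat (i' - i)) else 0)"
  by (auto simp: limit_kernel_def fscale_def fmul_xmon_complex pow_x2_plus_x0_eq)

text \<open>Since \<open>z ^ p = 1\<close>, the limit turns x1 into x2 + x0 and hence x1 - x2 into
  x0. On coefficients this is the \<open>n\<close>-th backward difference at x = a/p.\<close>

lemma limit_kernel_x1_minus_x2_pow: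
  assumes "p > 0" "z ^ p = 1"
  shows "Sum_any (\<lambda>c. limit_kernel p z c e * pow_x1_minus_x2 p (int n) (c - (0, a, b))) =
    limit_kernel p z (int n, a, b) e"
proof -
  obtain i a' b' where e: "e = (i, a', b')" by (cases e)
  have z: "z \<noteq> 0" using assms by (auto simp: power_0_left)
  \<comment> \<open>Across the terms of (x1 - x2)^n the exponent of x1^(1/p) changes by multiples of
    \<open>p\<close>, so all terms carry the same root-of-unity factor.\<close>
  have zp: "z powi (a + int p * m) = z powi a" for m
    using z assms(2) by (simp add: power_int_add power_int_mult)
  have bij: "bij (\<lambda>d. d + (0::int, a, b))"
    by (rule bij_plus_right)
  have "Sum_any (\<lambda>c. limit_kernel p z c e * pow_x1_minus_x2 p (int n) (c - (0, a, b))) =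
     Sum_any (\<lambda>d. pow_x1_minus_x2 p (int n) d * limit_kernel p z (d + (0, a, b)) e)"
    by (rule Sum_any.reindex_cong[OF bij]) (auto simp: mult.commute)
  also have "\<dots> = (\<Sum>j\<le>n. of_nat (n choose j) * (-1) ^ j *
      limit_kernel p z ((0, int p * (int n - int j), int p * int j) + (0, a, b)) e)"
    by (rule Sum_any_pow_x1_minus_x2_nat[OF vector_space_mult_complex assms(1)])
  \<comment> \<open>As (x1 - x2)^n is homogeneous, the condition on \<open>e\<close> is the same for
    every \<open>j\<close>.\<close>
  also have "\<dots> = (\<Sum>j\<le>n. if 0 \<le> i \<and> a' = 0 \<and> b' = a + b + int p * int n - int p * i
      then z powi a * (of_nat (n choose j) * (-1) ^ j *
        ((of_int a / of_nat p + of_nat n - of_nat j) gchoose nat i)) else 0)"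
  proof (rule sum.cong[OF refl])
    fix j assume "j \<in> {..n}"
    define A where "A = a + int p * (int n - int j)"
    have A: "of_int A / of_nat p = of_int a / of_nat p + of_nat n - (of_nat j :: complex)"
      "z powi A = z powi a"
      using assms(1) zp[of "int n - int j"] by (simp_all add: A_def field_simps)
    have c: "(0, int p * (int n - int j), int p * int j) + (0, a, b) = (0::int, A, int p * int j + b)"
      by (simp add: A_def)
    have "A + (int p * int j + b) - int p * (i - 0) = a + b + int p * int n - int p * i"
      by (simp add: A_def algebra_simps)
    then show "of_nat (n choose j) * (-1) ^ j *
       limit_kernel p z ((0, int p * (int n - int j), int p * int j) + (0, a, b)) e =
      (if 0 \<le> i \<and> a' = 0 \<and> b' = a + b + int p * int n - int p * i
      then z powi a * (of_nat (n choose j) * (-1) ^ j *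
        ((of_int a / of_nat p + of_nat n - of_nat j) gchoose nat i)) else 0)"
      unfolding e c limit_kernel_eq A by (simp add: mult.left_commute)
  qed
  also have "\<dots> = limit_kernel p z (int n, a, b) e"
  proof (cases "0 \<le> i \<and> a' = 0 \<and> b' = a + b + int p * int n - int p * i")
    case True
    then have "(n \<le> nat i) = (int n \<le> i)" "nat i - n = nat (i - int n)"
      "a' = 0" "b' = a + b - int p * (i - int n)"
      by (auto simp: algebra_simps)
    then show ?thesis
      by (simp only: True simp_thms if_True sum_distrib_left[symmetric]
          gbinomial_backward_difference e limit_kernel_eq) simp
  next
    case False
    then have "\<not> (int n \<le> i \<and> a' = 0 \<and> b' = a + b - int p * (i - int n))"
      by (auto simp: algebra_simps)
    then show ?thesis by (simp only: False if_False e limit_kernel_eq sum.neutral_const)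
  qed
  finally show ?thesis .
qed

section \<open>Passing from F to the product and to its limit\<close>

text \<open>Multiplication by (x1 - x2)^n acts on the image of each monomial of \<open>F\<close>
  separately, raising the power of x1 - x2 from \<open>i\<close> to \<open>n + i\<close>.\<close>

lemma x1_minus_x2_pow_mult_subst:
  assumes "vector_space s" "p > 0" "subst_x1_minus_x2 s p F P"
  shows "has_subst s (\<lambda>(i, a, b) e. pow_x1_minus_x2 p (int n + i) (e - (0, a, b))) F
    (fmul s (pow_x1_minus_x2 p (int n)) P)"
proof -
  interpret vector_space s by fact
  let ?m = "\<lambda>j. (0::int, int p * (int n - int j), int p * int j)"
  let ?c = "\<lambda>j. of_nat (n choose j) * (-1) ^ j :: complex"
  define \<psi> where "\<psi> = (\<lambda>(i, a, b) e. pow_x1_minus_x2 p i (e - (0, a, b)))"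
  define \<chi> where "\<chi> = (\<lambda>(i, a, b) e. pow_x1_minus_x2 p (int n + i) (e - (0, a, b)))"
  have fin: "finite {d. s (\<psi> d e) (F d) \<noteq> 0}" and P: "P e = Sum_any (\<lambda>d. s (\<psi> d e) (F d))" for e
  proof -
    have "(\<lambda>(i, a, b). fmul (*) (xmon 0 a b) (pow_x1_minus_x2 p i)) = \<psi>"
      by (auto simp: \<psi>_def fun_eq_iff fmul_xmon_complex)
    with assms(3) have "has_subst s \<psi> F P" by (simp only: subst_x1_minus_x2_def)
    then show "finite {d. s (\<psi> d e) (F d) \<noteq> 0}" "P e = Sum_any (\<lambda>d. s (\<psi> d e) (F d))"
      by (simp_all only: has_subst_def)
  qed
  show ?thesis
    unfolding has_subst_def \<chi>_def[symmetric]
  proof (intro allI conjI)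
    fix e :: "int \<times> int \<times> int"
    \<comment> \<open>The monomials of \<open>F\<close> contributing to \<open>P\<close> at any of
      the exponents \<open>e - ?m j\<close>: one finite set for all \<open>j\<close>, so that the
      sums can be exchanged.\<close>
    define D where "D = (\<Union>j\<le>n. {d. s (\<psi> d (e - ?m j)) (F d) \<noteq> 0})"
    have D: "finite D" using fin by (auto simp: D_def)
    have vandermonde: "(\<Sum>j\<le>n. ?c j * \<psi> d (e - ?m j)) = \<chi> d e" for d
    proof (cases d)
      case (fields i a b)
      then show ?thesis
        using pow_x1_minus_x2_add_nat[OF assms(2), of n i "e - (0, a, b)"]
        by (simp add: \<psi>_def \<chi>_def diff_diff_eq add.commute)
    qed
    \<comment> \<open>\<open>\<chi> d e\<close> is a linear combination of the values
      \<open>\<psi> d (e - ?m j)\<close>, all of whose contributions vanish off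
      \<open>D\<close>.\<close>
    have \<chi>_D: "{d. s (\<chi> d e) (F d) \<noteq> 0} \<subseteq> D"
    proof (rule subsetI, rule ccontr)
      fix d assume d: "d \<in> {d. s (\<chi> d e) (F d) \<noteq> 0}" "d \<notin> D"
      have "s (\<chi> d e) (F d) = (\<Sum>j\<le>n. s (?c j) (s (\<psi> d (e - ?m j)) (F d)))"
        by (simp flip: vandermonde add: scale_sum_left)
      also have "\<dots> = 0" using d(2) by (intro sum.neutral) (auto simp: D_def)
      finally show False using d(1) by simp
    qed
    have "fmul s (pow_x1_minus_x2 p (int n)) P e = (\<Sum>j\<le>n. s (?c j) (P (e - ?m j)))"
      unfolding fmul_def by (rule Sum_any_pow_x1_minus_x2_nat[OF assms(1,2)])
    also have "\<dots> = (\<Sum>j\<le>n. s (?c j) (\<Sum>d\<in>D. s (\<psi> d (e - ?m j)) (F d)))"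
    proof (rule sum.cong[OF refl])
      fix j assume "j \<in> {..n}"
      then have "P (e - ?m j) = (\<Sum>d\<in>D. s (\<psi> d (e - ?m j)) (F d))"
        unfolding P by (intro Sum_any.expand_superset D) (auto simp: D_def)
      then show "s (?c j) (P (e - ?m j)) = s (?c j) (\<Sum>d\<in>D. s (\<psi> d (e - ?m j)) (F d))"
        by simp
    qed
    also have "\<dots> = (\<Sum>d\<in>D. \<Sum>j\<le>n. s (?c j * \<psi> d (e - ?m j)) (F d))"
      by (subst sum.swap) (simp add: scale_sum_right)
    also have "\<dots> = (\<Sum>d\<in>D. s (\<chi> d e) (F d))"
      by (simp flip: vandermonde add: scale_sum_left)
    also have "\<dots> = Sum_any (\<lambda>d. s (\<chi> d e) (F d))"
      by (rule Sum_any.expand_superset[symmetric]) (use D \<chi>_D in auto)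
    finally have "fmul s (pow_x1_minus_x2 p (int n)) P e = Sum_any (\<lambda>d. s (\<chi> d e) (F d))" .
    with finite_subset[OF \<chi>_D D]
    show "finite {d. s (\<chi> d e) (F d) \<noteq> 0}"
      "Sum_any (\<lambda>d. s (\<chi> d e) (F d)) = fmul s (pow_x1_minus_x2 p (int n)) P e"
      by simp_all
  qed
qed

text \<open>A coefficient of the limit is a double sum over monomials \<open>d\<close> of
  \<open>F\<close> and monomials \<open>c\<close> of their images. Truncation confines the nonzero
  terms to finite boxes; after the exchange, the inner sum is the limit of the image of a single
  monomial.\<close>

lemma formal_limit_x1_minus_x2_pow_mult:
  fixes F :: "'a::ab_group_add fser"
  assumes "vector_space s" "p > 0" "\<omega> ^ p = 1"
    and F: "F \<in> laurent_x0_x1_x2" "fmul s (xmon (int n) 0 0) F \<in> power_x0_laurent_x1_x2"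
    and P: "subst_x1_minus_x2 s p F P"
    and H: "formal_limit s p \<omega> t F H"
  shows "formal_limit s p \<omega> t (fmul s (pow_x1_minus_x2 p (int n)) P) (fmul s (xmon (int n) 0 0) H)"
proof -
  interpret vector_space s by fact
  define z where "z = \<omega> powi t"
  have z: "z ^ p = 1"
    using assms(3) power_int_power[of \<omega> p t] by (simp add: z_def power_int_power' mult.commute)
  define \<chi> where "\<chi> = (\<lambda>(i, a, b) e. pow_x1_minus_x2 p (int n + i) (e - (0, a, b)))"
  define Q where "Q = fmul s (pow_x1_minus_x2 p (int n)) P"
  have \<chi>_fin: "finite {d. s (\<chi> d e) (F d) \<noteq> 0}" and Q: "Q e = Sum_any (\<lambda>d. s (\<chi> d e) (F d))" for e
    using x1_minus_x2_pow_mult_subst[OF assms(1,2) P, of n]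
    by (simp_all only: Q_def \<chi>_def has_subst_def)
  obtain N where N: "\<And>i a b. F (i, a, b) \<noteq> 0 \<Longrightarrow> N \<le> a \<and> N \<le> b"
    using F(1) unfolding laurent_x0_x1_x2_def by blast
  \<comment> \<open>Makes \<open>n + i\<close> natural, so that every relevant
    \<open>\<chi> d\<close> is a finite expansion.\<close>
  have i_ge: "0 \<le> int n + i" if "F (i, a, b) \<noteq> 0" for i a b
  proof -
    have "fmul s (xmon (int n) 0 0) F (int n + i, a, b) \<noteq> 0"
      using that by (simp add: fmul_xmon[OF assms(1)])
    then show ?thesis using F(2) unfolding power_x0_laurent_x1_x2_def by blast
  qed
  have L: "formal_limit s p \<omega> t = has_subst s (limit_kernel p z)"
    by (simp add: formal_limit_def limit_kernel_def z_def)
  show ?thesis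
    unfolding L has_subst_def Q_def[symmetric]
  proof (intro allI conjI)
    fix e :: "int \<times> int \<times> int"
    obtain i' a' b' where e: "e = (i', a', b')" by (cases e)
    \<comment> \<open>For \<open>c = (0, a1, b1)\<close> the kernel forces a1 + b1 = b' + p i' = R +
      N, and a1, b1 are at least \<open>N\<close>, hence at most \<open>R\<close>. For
      \<open>d = (i, a, b)\<close>, homogeneity gives p (n + i) = a1 + b1 - a - b, which is at most
      R - N; this bounds \<open>i\<close>.\<close>
    define R where "R = b' + int p * i' - N"
    define C where "C = {0::int} \<times> {N..R} \<times> {N..R}"
    define D where "D = {- int n..\<bar>R - N\<bar> - int n} \<times> {N..R} \<times> {N..R}"
    let ?g = "\<lambda>c d. s (limit_kernel p z c e * \<chi> d c) (F d)"
    have CD: "c \<in> C \<and> d \<in> D" if "?g c d \<noteq> 0" for c d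
    proof -
      obtain i a b i1 a1 b1 where d: "d = (i, a, b)" and c: "c = (i1, a1, b1)"
        by (cases c, cases d)
      from that have nz: "limit_kernel p z c e \<noteq> 0" "\<chi> d c \<noteq> 0" "F d \<noteq> 0" by auto
      obtain m where m: "int n + i = int m" using i_ge nz(3) d by (metis nonneg_int_cases)
      have "c - (0, a, b) \<in> {c. pow_x1_minus_x2 p (int m) c \<noteq> 0}"
        using nz(2) by (simp add: \<chi>_def d m)
      then obtain j where j: "j \<le> m" "i1 = 0" "a1 = a + int p * (int m - int j)" "b1 = b + int p * int j"
        using pow_x1_minus_x2_nat_support[OF assms(2), of m] by (auto simp: c algebra_simps)
      have "b' = a1 + b1 - int p * i'"
        using nz(1) j(2) by (auto simp: c e limit_kernel_eq split: if_splits)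
      then have ab: "a1 + b1 = R + N" by (simp add: R_def)
      have ge: "N \<le> a" "N \<le> b" "a \<le> a1" "b \<le> b1"
        using N nz(3) d j by auto
      have "int m \<le> int p * int m" using assms(2) mult_right_mono[of 1 "int p" "int m"] by simp
      also have "\<dots> = a1 + b1 - a - b" using j by (simp add: algebra_simps)
      also have "\<dots> \<le> \<bar>R - N\<bar>" using ab ge by simp
      finally show ?thesis using ge ab m j(2) by (auto simp: C_def D_def c d)
    qed
    have fin: "finite C" "finite D" by (auto simp: C_def D_def)
    have "{c. s (limit_kernel p z c e) (Q c) \<noteq> 0} \<subseteq> C"
    proof
      fix c assume "c \<in> {c. s (limit_kernel p z c e) (Q c) \<noteq> 0}"
      then have nz: "limit_kernel p z c e \<noteq> 0" "Q c \<noteq> 0" by auto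
      then obtain d where "s (\<chi> d c) (F d) \<noteq> 0"
        unfolding Q by (auto elim: Sum_any.not_neutral_obtains_not_neutral)
      then show "c \<in> C" using CD[of c d] nz(1) by simp
    qed
    then show "finite {c. s (limit_kernel p z c e) (Q c) \<noteq> 0}"
      using fin(1) by (rule finite_subset)
    have "Sum_any (\<lambda>c. s (limit_kernel p z c e) (Q c)) = Sum_any (\<lambda>c. Sum_any (\<lambda>d. ?g c d))"
    proof (rule Sum_any.cong)
      fix c
      have "s (limit_kernel p z c e) (Q c) =
          (\<Sum>d\<in>{d. s (\<chi> d c) (F d) \<noteq> 0}. ?g c d)"
        by (simp add: Q Sum_any.expand_set scale_sum_right)
      also have "\<dots> = Sum_any (\<lambda>d. ?g c d)"
        by (rule Sum_any.expand_superset[symmetric]) (use \<chi>_fin in auto)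
      finally show "s (limit_kernel p z c e) (Q c) = Sum_any (\<lambda>d. ?g c d)" .
    qed
    also have "\<dots> = Sum_any (\<lambda>d. Sum_any (\<lambda>c. ?g c d))"
      by (rule Sum_any.swap[of "C \<times> D"]) (use fin CD in blast)+
    also have "\<dots> = Sum_any (\<lambda>d. s (limit_kernel p z d (e - (int n, 0, 0))) (F d))"
    proof (rule Sum_any.cong)
      fix d
      show "Sum_any (\<lambda>c. ?g c d) = s (limit_kernel p z d (e - (int n, 0, 0))) (F d)"
      proof (cases "F d = 0")
        case False
        obtain i a b where d: "d = (i, a, b)" by (cases d)
        obtain m where m: "int n + i = int m" using i_ge False d by (metis nonneg_int_cases)
        let ?h = "\<lambda>c. limit_kernel p z c e * \<chi> d c"
        have h: "{c. ?h c \<noteq> 0} \<subseteq> C"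
        proof
          fix c assume "c \<in> {c. ?h c \<noteq> 0}"
          then show "c \<in> C" using CD[of c d] False by simp
        qed
        have "Sum_any (\<lambda>c. ?g c d) = (\<Sum>c\<in>C. ?g c d)"
          by (rule Sum_any.expand_superset) (use fin CD in blast)+
        also have "\<dots> = s (Sum_any ?h) (F d)"
          by (simp only: Sum_any.expand_superset[OF fin(1) h] scale_sum_left)
        also have "Sum_any ?h = limit_kernel p z (int m, a, b) e"
          using limit_kernel_x1_minus_x2_pow[OF assms(2) z, of e m a b] by (simp add: \<chi>_def d m)
        \<comment> \<open>The kernel sees the exponents of x0 only through their difference, so a
          factor x0^n amounts to a shift of \<open>e\<close>.\<close>
        also have "\<dots> = limit_kernel p z d (e - (int n, 0, 0))"
          using m by (simp add: d e limit_kernel_eq algebra_simps)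
        finally show ?thesis .
      qed simp
    qed
    also have "\<dots> = fmul s (xmon (int n) 0 0) H e"
      using H by (simp only: L has_subst_def fmul_xmon[OF assms(1)])
    finally show "Sum_any (\<lambda>c. s (limit_kernel p z c e) (Q c)) = fmul s (xmon (int n) 0 0) H e" .
  qed
qed

section \<open>Modified weak associativity\<close>

theorem theorem3p3:
  fixes sV :: "complex \<Rightarrow> 'v::ab_group_add \<Rightarrow> 'v"
    and Vgr :: "int \<Rightarrow> 'v set"
    and Y :: "'v \<Rightarrow> int \<Rightarrow> 'v \<Rightarrow> 'v"
    and vac om :: 'v
    and \<nu> :: "'v \<Rightarrow> 'v"
    and p :: nat
    and \<omega>\<^sub>p :: complex
    and sM :: "complex \<Rightarrow> 'm::ab_group_add \<Rightarrow> 'm"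
    and YM :: "'v \<Rightarrow> int \<Rightarrow> 'm \<Rightarrow> 'm"
    and k :: "'v \<Rightarrow> 'v \<Rightarrow> nat"
  assumes "vertex_operator_algebra sV Vgr Y vac om"
    and "p > 0"
    and "voa_automorphism sV Y vac om p \<nu>"
    and "primitive_root_of_unity p \<omega>\<^sub>p"
    and "vector_space sM"
    and "vertex_operator_map sV sM YM"
    and "truncation_condition p YM"
    and "twisted_jacobi sM p \<omega>\<^sub>p \<nu> Y YM"
    and "property_A sM p \<omega>\<^sub>p \<nu> Y YM k"
  shows "\<forall>(u :: 'v) (v :: 'v) (s :: int) (w :: 'm).
    formal_limit sM p \<omega>\<^sub>p s
      (fmul sM (pow_x1_minus_x2 p (int (k u v))) (prod_x1_x2 YM u v w))
      (fmul sM (xmon (int (k u v)) 0 0) (iterate_x0_x2 Y YM (int_iterate \<nu> (- s) u) v w))"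
proof (intro allI)
  \<comment> \<open>The operator identity is checked on each vector \<open>w\<close>, because the
    series F of property (A) depends on \<open>w\<close>.\<close>
  fix u v :: 'v and s :: int and w :: 'm
  from assms(9) obtain F where "F \<in> laurent_x0_x1_x2"
    "fmul sM (xmon (int (k u v)) 0 0) F \<in> power_x0_laurent_x1_x2"
    "subst_x1_minus_x2 sM p F (prod_x1_x2 YM u v w)"
    "formal_limit sM p \<omega>\<^sub>p s F (iterate_x0_x2 Y YM (int_iterate \<nu> (- s) u) v w)"
    unfolding property_A_def by blast
  then show "formal_limit sM p \<omega>\<^sub>p s
      (fmul sM (pow_x1_minus_x2 p (int (k u v))) (prod_x1_x2 YM u v w))
      (fmul sM (xmon (int (k u v)) 0 0) (iterate_x0_x2 Y YM (int_iterate \<nu> (- s) u) v w))"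
    using assms(2,4,5)
    by (intro formal_limit_x1_minus_x2_pow_mult) (auto simp: primitive_root_of_unity_def)
qed

end
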